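(* Let $G$ be a connected graph on $n$ vertices with maximum degree $\Delta$, and let $T$ be the spanning tree returned by the algorithm $\textsc{CongSpanTree}(G)$ (described in the context) when step 3 uses the Arora–Rao–Vazirani balanced-cut algorithm. Then $c(G,T)\le \mathcal{O}(\Delta\cdot \log^{3/2} n)\cdot \mathrm{STC}(G)$, i.e. the algorithm is an $\mathcal{O}(\Delta\cdot\log^{3/2} n)$-approximation for the spanning tree congestion problem. If moreover $G$ belongs to a class of graphs excluding some fixed graph as a minor and step 3 uses the Klein–Plotkin–Rao balanced-cut algorithm, then $c(G,T)\le \mathcal{O}(\Delta\cdot\log n)\cdot \mathrm{STC}(G)$.
   Context: For a connected graph $G=(V,E)$ and a spanning tree $T$ of $G$: for a tree edge $uv$, let $S_u,S_v$ be the vertex sets of the two components of $T$ minus $uv$; the congestion $c(uv)$ is the number of edges of $G$ between $S_u$ and $S_v$. The congestion of $T$ is $c(G,T)=\max_{e\in E(T)} c(e)$, and $\mathrm{STC}(G)$ is the minimum of $c(G,T)$ over all spanning trees $T$ of $G$. A bisection of a graph on $n$ vertices is a partition of its vertices into two parts each of size at most $\lceil n/2\rceil$; $b(G)$ is the minimum number of edges crossing a bisection. A $2/3$-balanced cut is a partition of the vertices into two sets each of size at most $2n/3$. The Arora–Rao–Vazirani algorithm computes in polynomial time a $2/3$-balanced cut whose number of crossing edges is at most $\mathcal{O}(\sqrt{\log n})\cdot b(H)$ for the input graph $H$; for graphs excluding a fixed minor, the Klein–Plotkin–Rao algorithm does the same with factor $\mathcal{O}(1)$. Algorithm $\textsc{CongSpanTree}(H)$: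 (1) if $H$ has one vertex, return $H$; (2) otherwise compute a $2/3$-balanced cut $(S,V(H)\setminus S)$ of $H$ using the chosen balanced-cut algorithm (step 3), and let $F$ be the set of edges crossing it; (3) for each connected component $C$ of $H$ with the edges of $F$ removed, recursively compute $T_C=\textsc{CongSpanTree}(C)$; (4) connect all trees $T_C$ arbitrarily by edges of $F$ into a spanning tree $T$ of $H$ and return $T$.
   Formalization: The balanced-cut algorithm is assumed to be within its factor of the best partition with parts at most max(⌈n/2⌉, βn), for a fixed 1/2<β<2/3, rather than of b(H); with only the b(H) guarantee the bound fails (ternary tree times K_2). *)

theory Defs
  imports Complex_Main
begin

type_synonym 'a graph = "'a set \<times> 'a set set"

abbreviation verts :: "'a graph \<Rightarrow> 'a set" where "verts \<equiv> fst"
abbreviation edges :: "'a graph \<Rightarrow> 'a set set" where "edges \<equiv> snd"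

definition simple_graph :: "'a graph \<Rightarrow> bool" where
  "simple_graph G \<longleftrightarrow>
     finite (verts G) \<and> edges G \<subseteq> {{u, v} | u v. u \<in> verts G \<and> v \<in> verts G \<and> u \<noteq> v}"

definition adj :: "'a graph \<Rightarrow> ('a \<times> 'a) set" where
  "adj G = {(u, v). {u, v} \<in> edges G}"

definition connected_graph :: "'a graph \<Rightarrow> bool" where
  "connected_graph G \<longleftrightarrow>
     verts G \<noteq> {} \<and> (\<forall>u \<in> verts G. \<forall>v \<in> verts G. (u, v) \<in> (adj G)\<^sup>*)"

definition component_of :: "'a graph \<Rightarrow> 'a \<Rightarrow> 'a set" where
  "component_of G v = {u \<in> verts G. (v, u) \<in> (adj G)\<^sup>*}"

definition components :: "'a graph \<Rightarrow> 'a set set" where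
  "components G = component_of G ` verts G"

definition induced :: "'a graph \<Rightarrow> 'a set \<Rightarrow> 'a graph" where
  "induced G W = (W, {e \<in> edges G. e \<subseteq> W})"

definition delete_edges :: "'a graph \<Rightarrow> 'a set set \<Rightarrow> 'a graph" where
  "delete_edges G F = (verts G, edges G - F)"

definition max_degree :: "'a graph \<Rightarrow> nat" where
  "max_degree G = Max ((\<lambda>v. card {e \<in> edges G. v \<in> e}) ` verts G)"

definition is_cycle :: "'a graph \<Rightarrow> 'a list \<Rightarrow> bool" where
  "is_cycle G p \<longleftrightarrow> 3 \<le> length p \<and> distinct p \<and>
     (\<forall>i. Suc i < length p \<longrightarrow> {p ! i, p ! Suc i} \<in> edges G) \<and> {last p, hd p} \<in> edges G"

definition is_tree :: "'a graph \<Rightarrow> bool" where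
  "is_tree T \<longleftrightarrow> simple_graph T \<and> connected_graph T \<and> (\<nexists>p. is_cycle T p)"

definition spanning_tree :: "'a graph \<Rightarrow> 'a graph \<Rightarrow> bool" where
  "spanning_tree T G \<longleftrightarrow> is_tree T \<and> verts T = verts G \<and> edges T \<subseteq> edges G"

definition edges_between :: "'a graph \<Rightarrow> 'a set \<Rightarrow> 'a set \<Rightarrow> 'a set set" where
  "edges_between G A B = {e \<in> edges G. \<exists>a \<in> A. \<exists>b \<in> B. e = {a, b}}"

definition edge_congestion :: "'a graph \<Rightarrow> 'a graph \<Rightarrow> 'a \<Rightarrow> 'a \<Rightarrow> nat" where
  "edge_congestion G T u v =
     (let T' = delete_edges T {{u, v}}
      in card (edges_between G (component_of T' u) (component_of T' v)))"

text \<open>The inserted 0 only matters for the one-vertex tree, which has no edges.\<close>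

definition congestion :: "'a graph \<Rightarrow> 'a graph \<Rightarrow> nat" where
  "congestion G T = Max (insert 0 {edge_congestion G T u v | u v. {u, v} \<in> edges T})"

definition STC :: "'a graph \<Rightarrow> nat" where
  "STC G = Min {congestion G T | T. spanning_tree T G}"

definition cut_edges :: "'a graph \<Rightarrow> 'a set \<Rightarrow> 'a set set" where
  "cut_edges G S = edges_between G S (verts G - S)"

definition two_thirds_balanced :: "'a graph \<Rightarrow> 'a set \<Rightarrow> bool" where
  "two_thirds_balanced G S \<longleftrightarrow> S \<subseteq> verts G \<and>
     real (card S) \<le> 2 * real (card (verts G)) / 3 \<and>
     real (card (verts G - S)) \<le> 2 * real (card (verts G)) / 3"

text \<open>
  The minimum number of edges crossing a partition into two parts of size at most \<open>\<beta> n\<close>.  Rounding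
  to \<open>\<lceil>n/2\<rceil>\<close> keeps bisections admissible for every \<open>n\<close>; for \<open>\<beta> \<le> 1/2\<close> the value is the bisection
  width \<open>b(G)\<close>, and it decreases as \<open>\<beta>\<close> grows.
\<close>

definition balanced_width :: "real \<Rightarrow> 'a graph \<Rightarrow> nat" where
  "balanced_width \<beta> G =
     (let n = real (card (verts G)); m = max (of_int \<lceil>n / 2\<rceil>) (\<beta> * n)
      in Min {card (cut_edges G S) | S.
           S \<subseteq> verts G \<and> real (card S) \<le> m \<and> real (card (verts G - S)) \<le> m})"

text \<open>
  Balanced-cut algorithms enter only through their approximation guarantee on a class \<open>P\<close> of graphs.
  The Arora-Rao-Vazirani and Klein-Plotkin-Rao algorithms meet it for each constant \<open>\<beta> < 2/3\<close>, with a
  constant depending on \<open>\<beta>\<close>.  For \<open>\<beta> = 1/2\<close> it compares with \<open>b(H)\<close>, and it implies that comparison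
  for every \<open>\<beta>\<close>.  The benchmark \<open>b(H)\<close> alone is too coarse a description of these algorithms: complete
  ternary trees have bounded degree and spanning tree congestion 1, but bisection width of order
  \<open>log n\<close>.
\<close>

definition balanced_cut_guarantee ::
  "real \<Rightarrow> (nat \<Rightarrow> real) \<Rightarrow> ('a graph \<Rightarrow> bool) \<Rightarrow> ('a graph \<Rightarrow> 'a set) \<Rightarrow> bool" where
  "balanced_cut_guarantee \<beta> \<alpha> P bcut \<longleftrightarrow>
     (\<forall>H. simple_graph H \<and> P H \<and> 2 \<le> card (verts H) \<longrightarrow>
        two_thirds_balanced H (bcut H) \<and>
        real (card (cut_edges H (bcut H))) \<le> \<alpha> (card (verts H)) * real (balanced_width \<beta> H))"

text \<open>
  \<open>cong_span_tree bcut H T\<close>: the tree \<open>T\<close> is a possible result of the recursive algorithm on \<open>H\<close>.  It is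
  a relation because the trees of the components may be joined by edges of \<open>F\<close> in any way.
\<close>

inductive cong_span_tree :: "('a graph \<Rightarrow> 'a set) \<Rightarrow> 'a graph \<Rightarrow> 'a graph \<Rightarrow> bool"
  for bcut :: "'a graph \<Rightarrow> 'a set" where
  single: "card (verts H) = 1 \<Longrightarrow> cong_span_tree bcut H H"
| split: "\<lbrakk> 2 \<le> card (verts H);
            F = cut_edges H (bcut H);
            \<forall>C \<in> components (delete_edges H F).
              cong_span_tree bcut (induced (delete_edges H F) C) (T\<^sub>C C);
            spanning_tree T H;
            F' \<subseteq> F;
            edges T = (\<Union>C \<in> components (delete_edges H F). edges (T\<^sub>C C)) \<union> F' \<rbrakk>
          \<Longrightarrow> cong_span_tree bcut H T"

definition has_minor :: "'a graph \<Rightarrow> 'b graph \<Rightarrow> bool" where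
  "has_minor G M \<longleftrightarrow> (\<exists>\<phi> :: 'b \<Rightarrow> 'a set.
     (\<forall>x \<in> verts M. \<phi> x \<subseteq> verts G \<and> connected_graph (induced G (\<phi> x))) \<and>
     (\<forall>x \<in> verts M. \<forall>y \<in> verts M. x \<noteq> y \<longrightarrow> \<phi> x \<inter> \<phi> y = {}) \<and>
     (\<forall>x y. {x, y} \<in> edges M \<longrightarrow> edges_between G (\<phi> x) (\<phi> y) \<noteq> {}))"

end

theory Submission
  imports Defs
begin

text \<open>
  A cut crossed by few edges of a spanning tree \<open>T\<close> is crossed by few edges of \<open>G\<close>: each edge of \<open>G\<close> in
  the cut is charged to a tree edge in the cut, and a tree edge is charged at most \<open>c(G, T)\<close> times.
  Splitting at centroids \<open>j\<close> times produces, for every vertex set \<open>C\<close>, a cut of \<open>T\<close> with at most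
  \<open>j \<Delta>\<close> edges that splits \<open>C\<close> in any prescribed proportion up to an error of \<open>|C| / 2^j\<close>.  Applied to an
  optimal tree with \<open>j\<close> depending only on \<open>\<beta>\<close>, this bounds the \<open>\<beta>\<close>-balanced width of every induced
  subgraph by \<open>O(\<Delta>) STC(G)\<close>.  Each level of the recursion adds at most one balanced cut to the congestion
  of an edge, and there are \<open>O(log n)\<close> levels.
\<close>

section \<open>Reachability\<close>

lemma adj_commute: "(x, y) \<in> adj G \<longleftrightarrow> (y, x) \<in> adj G"
  by (simp add: adj_def insert_commute)

lemma adj_rtrancl_sym: "(x, y) \<in> (adj G)\<^sup>* \<Longrightarrow> (y, x) \<in> (adj G)\<^sup>*"
  using sym_rtrancl[of "adj G"] by (auto simp: sym_def adj_commute)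

lemma adj_rtrancl_mono: "(x, y) \<in> (adj G)\<^sup>* \<Longrightarrow> edges G \<subseteq> edges H \<Longrightarrow> (x, y) \<in> (adj H)\<^sup>*"
  using rtrancl_mono[of "adj G" "adj H"] by (auto simp: adj_def)

lemma simple_graph_edge:
  assumes "simple_graph G" "{x, y} \<in> edges G"
  shows "x \<in> verts G" "y \<in> verts G" "x \<noteq> y"
  using assms by (auto simp: simple_graph_def doubleton_eq_iff)

lemma simple_graph_edgeE:
  assumes "simple_graph G" "e \<in> edges G"
  obtains x y where "e = {x, y}" "x \<in> verts G" "y \<in> verts G" "x \<noteq> y"
  using assms by (auto simp: simple_graph_def)

lemma simple_graph_finite_edges: "simple_graph G \<Longrightarrow> finite (edges G)"
  by (rule finite_subset[of _ "Pow (verts G)"]) (auto simp: simple_graph_def)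

lemma simple_graph_induced:
  assumes "simple_graph G" "W \<subseteq> verts G"
  shows "simple_graph (induced G W)"
proof -
  have "finite W"
    using assms by (auto simp: simple_graph_def intro: finite_subset)
  moreover have "\<exists>u v. e = {u, v} \<and> u \<in> W \<and> v \<in> W \<and> u \<noteq> v" if "e \<in> edges G" "e \<subseteq> W" for e
    using simple_graph_edgeE[OF assms(1) that(1)] that(2) by (metis insert_subset)
  ultimately show ?thesis
    by (simp add: simple_graph_def induced_def subset_iff)
qed

lemma induced_induced: "D \<subseteq> W \<Longrightarrow> induced (induced G W) D = induced G D"
  by (auto simp: induced_def)

lemma rtrancl_exits:
  assumes "(x, y) \<in> R\<^sup>*" "x \<in> D" "y \<notin> D"
  obtains a b where "(a, b) \<in> R" "a \<in> D" "b \<notin> D"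
  using assms by (induction rule: rtrancl_induct) blast+

text \<open>A walk never needs the new edge twice: crossing it back returns to an endpoint that was
  already reachable from \<open>x\<close> without it. The two last cases are the two directions of
  the single crossing.\<close>

lemma adj_rtrancl_insert:
  assumes "(x, y) \<in> (adj (V, insert {u, v} E))\<^sup>*"
  shows "(x, y) \<in> (adj (V, E))\<^sup>* \<or>
    (x, u) \<in> (adj (V, E))\<^sup>* \<and> (v, y) \<in> (adj (V, E))\<^sup>* \<or>
    (x, v) \<in> (adj (V, E))\<^sup>* \<and> (u, y) \<in> (adj (V, E))\<^sup>*"
  using assms
proof (induction rule: rtrancl_induct)
  case (step y z)
  consider "(y, z) \<in> adj (V, E)" | "y = u" "z = v" | "y = v" "z = u"
    using step.hyps(2) by (auto simp: adj_def doubleton_eq_iff)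
  then show ?case
    using step.IH by cases (auto intro: rtrancl_into_rtrancl)
qed simp

text \<open>Insert the edges of \<open>F\<close> one at a time: the edge whose insertion first
  connects \<open>x\<close> to \<open>y\<close> is the one sought. Edges inserted later only add
  walks, so both half-walks persist in the full graph without that edge.\<close>

lemma adj_rtrancl_critical_edge:
  assumes "finite F" "E \<inter> F = {}" "\<And>f. f \<in> F \<Longrightarrow> \<exists>u v. f = {u, v}"
    and "(x, y) \<in> (adj (V, E \<union> F))\<^sup>*" "(x, y) \<notin> (adj (V, E))\<^sup>*"
  shows "\<exists>u v. {u, v} \<in> F \<and> (x, u) \<in> (adj (V, (E \<union> F) - {{u, v}}))\<^sup>* \<and>
    (v, y) \<in> (adj (V, (E \<union> F) - {{u, v}}))\<^sup>*"
  using assms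
proof (induction F rule: finite_induct)
  case (insert f F)
  show ?case
  proof (cases "(x, y) \<in> (adj (V, E \<union> F))\<^sup>*")
    case True
    then obtain u v where uv: "{u, v} \<in> F" "(x, u) \<in> (adj (V, (E \<union> F) - {{u, v}}))\<^sup>*"
      "(v, y) \<in> (adj (V, (E \<union> F) - {{u, v}}))\<^sup>*"
      using insert.IH insert.prems by blast
    have "edges (V, (E \<union> F) - {{u, v}}) \<subseteq> edges (V, (E \<union> insert f F) - {{u, v}})"
      by auto
    with uv show ?thesis
      by (meson adj_rtrancl_mono insertCI)
  next
    case False
    obtain u v where f: "f = {u, v}"
      using insert.prems(2) by blast
    have "(x, y) \<in> (adj (V, insert {u, v} (E \<union> F)))\<^sup>*"
      using insert.prems(3) f by simp
    from adj_rtrancl_insert[OF this] False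
    consider "(x, u) \<in> (adj (V, E \<union> F))\<^sup>*" "(v, y) \<in> (adj (V, E \<union> F))\<^sup>*"
      | "(x, v) \<in> (adj (V, E \<union> F))\<^sup>*" "(u, y) \<in> (adj (V, E \<union> F))\<^sup>*"
      by fast
    \<comment> \<open>As \<open>f\<close> lies neither in \<open>E\<close> nor in \<open>F\<close>,
      deleting it restores exactly the graph before the insertion. Both orientations of
      \<open>f\<close> occur in the case distinction.\<close>
    moreover have "(E \<union> insert f F) - {{u, v}} = E \<union> F" "(E \<union> insert f F) - {{v, u}} = E \<union> F"
      using insert.prems(1) insert.hyps f by (auto simp: insert_commute)
    moreover have "{u, v} \<in> insert f F" "{v, u} \<in> insert f F"
      using f by (auto simp: insert_commute)
    ultimately show ?thesis
      by cases (rule exI, rule exI, rule conjI, assumption, simp)+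
  qed
qed simp

section \<open>Components\<close>

lemma component_subset: "D \<in> components G \<Longrightarrow> D \<subseteq> verts G"
  by (auto simp: components_def component_of_def)

lemma component_nonempty: "D \<in> components G \<Longrightarrow> D \<noteq> {}"
  by (auto simp: components_def component_of_def)

lemma component_reachable:
  "D \<in> components G \<Longrightarrow> x \<in> D \<Longrightarrow> y \<in> D \<Longrightarrow> (x, y) \<in> (adj G)\<^sup>*"
  by (auto simp: components_def component_of_def intro: adj_rtrancl_sym rtrancl_trans)

lemma component_closed:
  "D \<in> components G \<Longrightarrow> x \<in> D \<Longrightarrow> (x, y) \<in> (adj G)\<^sup>* \<Longrightarrow> y \<in> verts G \<Longrightarrow> y \<in> D"
  by (auto simp: components_def component_of_def intro: rtrancl_trans)

lemma component_closed_edge: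
  assumes "D \<in> components G" "x \<in> D" "{x, y} \<in> edges G" "y \<in> verts G"
  shows "y \<in> D"
  using assms component_closed[of D G x y] by (auto simp: adj_def)

lemma component_eqI:
  assumes "D \<in> components G" "E \<in> components G" "x \<in> D" "x \<in> E"
  shows "D = E"
proof -
  have "D \<subseteq> E" if "D \<in> components G" "E \<in> components G" "x \<in> D" "x \<in> E" for D E
    using component_closed[OF that(2,4) component_reachable[OF that(1,3)]] component_subset[OF that(1)]
    by blast
  then show ?thesis
    using assms by blast
qed

lemma Union_components: "\<Union> (components G) = verts G"
  by (auto simp: components_def component_of_def)

text \<open>A walk that starts in a component cannot leave it, so each of its edges survives in the
  induced subgraph.\<close>

lemma connected_graph_induced_component:
  assumes "simple_graph G" "D \<in> components G"
  shows "connected_graph (induced G D)"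
proof -
  have "y \<in> D \<and> (x, y) \<in> (adj (induced G D))\<^sup>*" if "(x, y) \<in> (adj G)\<^sup>*" "x \<in> D" for x y
    using that(1)
  proof (induction rule: rtrancl_induct)
    case (step y z)
    then have yz: "{y, z} \<in> edges G" "y \<in> D"
      by (auto simp: adj_def)
    moreover have "z \<in> D"
      using yz component_closed_edge[OF assms(2)] simple_graph_edge[OF assms(1)] by blast
    ultimately have "(y, z) \<in> adj (induced G D)"
      by (auto simp: adj_def induced_def)
    with step.IH \<open>z \<in> D\<close> show ?case
      by (meson rtrancl.rtrancl_into_rtrancl)
  qed (use that in simp)
  moreover have "D \<noteq> {}" "\<And>x y. x \<in> D \<Longrightarrow> y \<in> D \<Longrightarrow> (x, y) \<in> (adj G)\<^sup>*"
    using component_nonempty[OF assms(2)] component_reachable[OF assms(2)] by simp_all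
  moreover have "verts (induced G D) = D"
    by (simp add: induced_def)
  ultimately show ?thesis
    unfolding connected_graph_def by metis
qed

section \<open>Trees\<close>

text \<open>The path is built backwards from \<open>y\<close>. When the new first vertex already
  lies on it, the part before that occurrence is dropped.\<close>

lemma rtrancl_distinct_path:
  assumes "(x, y) \<in> R\<^sup>*"
  shows "\<exists>p. p \<noteq> [] \<and> hd p = x \<and> last p = y \<and> distinct p \<and> successively (\<lambda>a b. (a, b) \<in> R) p"
  using assms
proof (induction rule: converse_rtrancl_induct)
  case base
  show ?case
    by (rule exI[of _ "[y]"]) simp
next
  case (step x z)
  then obtain p where p: "p \<noteq> []" "hd p = z" "last p = y" "distinct p"
    "successively (\<lambda>a b. (a, b) \<in> R) p"
    by blast
  show ?case
  proof (cases "x \<in> set p")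
    case True
    then obtain q r where "p = q @ x # r"
      by (meson split_list)
    with p show ?thesis
      by (intro exI[of _ "x # r"]) (auto simp: successively_append_iff)
  next
    case False
    with p step.hyps(1) show ?thesis
      by (intro exI[of _ "x # p"]) (auto simp: successively_Cons)
  qed
qed

text \<open>A simple path from \<open>u\<close> to \<open>v\<close> that avoids the edge closes up
  with it to a cycle. Length 1 would mean \<open>u = v\<close>, and length 2 would be the deleted
  edge itself, so the path has the three vertices that \<open>is_cycle\<close> demands.\<close>

lemma tree_edge_is_bridge:
  assumes "is_tree T" "{u, v} \<in> edges T"
  shows "(u, v) \<notin> (adj (delete_edges T {{u, v}}))\<^sup>*"
proof
  assume "(u, v) \<in> (adj (delete_edges T {{u, v}}))\<^sup>*"
  then obtain p where p: "p \<noteq> []" "hd p = u" "last p = v" "distinct p"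
    "successively (\<lambda>a b. (a, b) \<in> adj (delete_edges T {{u, v}})) p"
    using rtrancl_distinct_path by metis
  have ne: "u \<noteq> v"
    using assms(1) simple_graph_edge(3)[OF _ assms(2)] by (simp add: is_tree_def)
  have step: "{p ! i, p ! Suc i} \<in> edges T - {{u, v}}" if "Suc i < length p" for i
    using p(5) that by (auto simp: successively_conv_nth adj_def delete_edges_def)
  have "length p \<noteq> 1"
    using p ne by (cases p) auto
  moreover have "length p \<noteq> 2"
  proof
    assume "length p = 2"
    then have "p = [u, v]"
      using p by (auto simp: numeral_2_eq_2 length_Suc_conv)
    then show False
      using step[of 0] by simp
  qed
  moreover have "length p \<noteq> 0"
    using p by simp
  ultimately have "3 \<le> length p"
    by linarith
  then have "is_cycle T p"
    using p step assms(2) by (auto simp: is_cycle_def insert_commute)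
  then show False
    using assms(1) by (auto simp: is_tree_def)
qed

lemma is_tree_induced:
  assumes "is_tree T" "D \<subseteq> verts T" "connected_graph (induced T D)"
  shows "is_tree (induced T D)"
proof -
  have "is_cycle T p" if "is_cycle (induced T D) p" for p
    using that by (auto simp: is_cycle_def induced_def)
  then show ?thesis
    using assms simple_graph_induced[OF _ assms(2)] by (auto simp: is_tree_def)
qed

text \<open>Otherwise every vertex \<open>v\<close> has a component of \<open>T - v\<close> with
  more than half of \<open>C\<close>. Take such a pair with the fewest vertices in the component
  \<open>D\<close>, and step from \<open>v\<close> to its neighbour \<open>u\<close> in
  \<open>D\<close>: the heavy component at \<open>u\<close> turns out to be a proper subset of
  \<open>D\<close>. The minimised quantity is \<open>card D\<close>, not
  \<open>card (D \<inter> C)\<close>, because the lost vertex \<open>u\<close> need not lie in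
  \<open>C\<close>.\<close>

lemma tree_centroid:
  assumes T: "is_tree T" and C: "C \<subseteq> verts T"
  shows "\<exists>v \<in> verts T. \<forall>D \<in> components (induced T (verts T - {v})). 2 * card (D \<inter> C) \<le> card C"
proof (rule ccontr)
  define P where "P v D \<longleftrightarrow> v \<in> verts T \<and> D \<in> components (induced T (verts T - {v})) \<and>
    card C < 2 * card (D \<inter> C)" for v D
  assume "\<not> ?thesis"
  then have heavy: "\<exists>D. P v D" if "v \<in> verts T" for v
    using that by (auto simp: P_def not_le)
  have sT: "simple_graph T" and cT: "connected_graph T"
    using T by (auto simp: is_tree_def)
  then obtain v\<^sub>0 where "v\<^sub>0 \<in> verts T"
    by (auto simp: connected_graph_def)
  then obtain p where p: "P (fst p) (snd p)" "\<And>q. P (fst q) (snd q) \<Longrightarrow> card (snd p) \<le> card (snd q)"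
    using heavy ex_has_least_nat[of "\<lambda>p. P (fst p) (snd p)" _ "\<lambda>p. card (snd p)"] by (metis fst_conv snd_conv)
  define v D where "v = fst p" and "D = snd p"
  have vD: "P v D" and least: "\<And>u E. P u E \<Longrightarrow> card D \<le> card E"
    using p unfolding v_def D_def by (metis fst_conv snd_conv)+
  have D: "D \<in> components (induced T (verts T - {v}))" "D \<subseteq> verts T - {v}" "v \<in> verts T"
    using vD component_subset[of D "induced T (verts T - {v})"] by (auto simp: P_def induced_def)
  have exit: "b = v" if "{a, b} \<in> edges T" "a \<in> D" "b \<notin> D" for a b
    using that D component_closed_edge[OF D(1), of a b] simple_graph_edge[OF sT, of a b]
    by (auto simp: induced_def)
  obtain z where "z \<in> D"
    using component_nonempty[OF D(1)] by blast
  then have "(z, v) \<in> (adj T)\<^sup>*"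
    using D cT by (auto simp: connected_graph_def)
  moreover have "v \<notin> D"
    using D(2) by blast
  ultimately obtain u v' where "(u, v') \<in> adj T" "u \<in> D" "v' \<notin> D"
    using \<open>z \<in> D\<close> by (meson rtrancl_exits)
  then have u: "u \<in> D" "{u, v} \<in> edges T"
    using exit[of u v'] by (auto simp: adj_def)
  then obtain D' where uD': "P u D'"
    using heavy D(2) by blast
  then have D': "D' \<in> components (induced T (verts T - {u}))" "D' \<subseteq> verts T - {u}"
    using component_subset[of D' "induced T (verts T - {u})"] by (auto simp: P_def induced_def)
  have fin: "finite C" "finite D"
    using C D(2) sT by (auto simp: simple_graph_def intro: finite_subset)
  \<comment> \<open>Two disjoint sets cannot both contain more than half of
    \<open>C\<close>.\<close>
  have "D \<inter> D' \<noteq> {}"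
  proof
    assume "D \<inter> D' = {}"
    then have "card (D \<inter> C) + card (D' \<inter> C) = card ((D \<inter> C) \<union> (D' \<inter> C))"
      using fin by (intro card_Un_disjoint[symmetric]) auto
    also have "\<dots> \<le> card C"
      using fin by (intro card_mono) auto
    finally show False
      using vD uD' by (auto simp: P_def)
  qed
  then obtain w where w: "w \<in> D" "w \<in> D'"
    by blast
  \<comment> \<open>Leaving \<open>D\<close> is possible only through \<open>v\<close>, and in
    \<open>T - u\<close> only along an edge from some \<open>a\<close> other than \<open>u\<close>.
    Walking from \<open>u\<close> to \<open>a\<close> inside \<open>D\<close> and then to
    \<open>v\<close> would bypass the bridge \<open>uv\<close>.\<close>
  have "D' \<subseteq> D"
  proof (rule ccontr)
    assume "\<not> D' \<subseteq> D"
    then obtain y where y: "y \<in> D'" "y \<notin> D"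
      by blast
    then have "(w, y) \<in> (adj (induced T (verts T - {u})))\<^sup>*"
      using w component_reachable[OF D'(1)] by blast
    then obtain a b where ab: "(a, b) \<in> adj (induced T (verts T - {u}))" "a \<in> D" "b \<notin> D"
      using w y by (meson rtrancl_exits)
    then have a: "{a, v} \<in> edges T" "a \<noteq> u" "v \<noteq> u"
      using exit[of a b] by (auto simp: adj_def induced_def)
    let ?T = "delete_edges T {{u, v}}"
    have "(u, a) \<in> (adj ?T)\<^sup>*"
      using component_reachable[OF D(1) u(1) ab(2)]
      by (rule adj_rtrancl_mono) (auto simp: induced_def delete_edges_def)
    moreover have "(a, v) \<in> adj ?T"
      using a by (auto simp: adj_def delete_edges_def doubleton_eq_iff)
    ultimately show False
      using tree_edge_is_bridge[OF T u(2)] by (meson rtrancl.rtrancl_into_rtrancl)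
  qed
  then have "D' \<subset> D"
    using u(1) D'(2) by blast
  from psubset_card_mono[OF fin(2) this] show False
    using least[OF uD'] by simp
qed

section \<open>Tree cuts of prescribed proportion\<close>

lemma cut_edgesE:
  assumes "e \<in> cut_edges G A"
  obtains a b where "e = {a, b}" "{a, b} \<in> edges G" "a \<in> A" "b \<in> verts G" "b \<notin> A"
  using assms by (auto simp: cut_edges_def edges_between_def)

lemma cut_edgesI:
  "{a, b} \<in> edges G \<Longrightarrow> a \<in> A \<Longrightarrow> b \<in> verts G \<Longrightarrow> b \<notin> A \<Longrightarrow> {a, b} \<in> cut_edges G A"
  by (auto simp: cut_edges_def edges_between_def)

lemma cut_edges_subset: "cut_edges G A \<subseteq> edges G"
  by (auto simp: cut_edges_def edges_between_def)

text \<open>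
  Removing a centroid leaves components of at most half the weight; a maximal family of them of total
  weight at most \<open>t\<close> misses \<open>t\<close> by less than the weight of one further component, into which we recurse.
\<close>

lemma tree_cut_approximating_size:
  assumes "is_tree T" "C \<subseteq> verts T" "t \<le> card C"
    and "\<And>v. v \<in> verts T \<Longrightarrow> card {e \<in> edges T. v \<in> e} \<le> d"
  shows "\<exists>A \<subseteq> verts T. card (cut_edges T A) \<le> j * d \<and> card (A \<inter> C) \<le> t \<and>
    2 ^ j * t \<le> 2 ^ j * card (A \<inter> C) + card C"
  using assms
proof (induction j arbitrary: T C t)
  case 0
  show ?case
    using 0 by (intro exI[of _ "{}"]) (auto simp: cut_edges_def edges_between_def)
next
  case (Suc j)
  note T = \<open>is_tree T\<close> and C = \<open>C \<subseteq> verts T\<close> and deg = Suc.prems(4)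
  have sT: "simple_graph T"
    using T by (simp add: is_tree_def)
  have finV: "finite (verts T)" and finE: "finite (edges T)"
    using sT simple_graph_finite_edges[OF sT] by (auto simp: simple_graph_def)
  have finC: "finite C"
    using C finV finite_subset by blast
  show ?case
  proof (cases "t = card C")
    case True
    have "cut_edges T (verts T) = {}"
      by (auto simp: cut_edges_def edges_between_def)
    then show ?thesis
      using True C by (intro exI[of _ "verts T"]) (auto simp: Int_absorb1)
  next
    case False
    obtain v where v: "v \<in> verts T"
      and half: "\<And>D. D \<in> components (induced T (verts T - {v})) \<Longrightarrow> 2 * card (D \<inter> C) \<le> card C"
      using tree_centroid[OF T C] by blast
    define W where "W = induced T (verts T - {v})"
    have sW: "simple_graph W"
      unfolding W_def using sT by (auto intro: simple_graph_induced)
    have vW: "verts W = verts T - {v}"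
      by (simp add: W_def induced_def)
    have closed: "b \<in> D" if "D \<in> components W" "a \<in> D" "{a, b} \<in> edges T" "v \<notin> {a, b}" for D a b
      using that component_closed_edge[OF that(1,2), of b] simple_graph_edge[OF sT that(3)]
      by (auto simp: W_def induced_def)
    \<comment> \<open>Maximality under inclusion suffices: it makes any single further component
      overshoot the target \<open>t\<close>.\<close>
    define Q where "Q \<D> \<longleftrightarrow> \<D> \<subseteq> components W \<and> card (\<Union>\<D> \<inter> C) \<le> t" for \<D>
    have fin: "finite (components W)"
      using finV vW by (auto simp: components_def)
    have "finite {\<D>. Q \<D>}"
      by (rule finite_subset[of _ "Pow (components W)"]) (use fin in \<open>auto simp: Q_def\<close>)
    moreover have "{} \<in> {\<D>. Q \<D>}"
      by (simp add: Q_def)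
    ultimately have "\<exists>\<D> \<in> {\<D>. Q \<D>}. {} \<subseteq> \<D> \<and> (\<forall>\<E> \<in> {\<D>. Q \<D>}. \<D> \<subseteq> \<E> \<longrightarrow> \<D> = \<E>)"
      by (rule finite_has_maximal2)
    then obtain \<D> where \<D>: "Q \<D>" and max: "\<And>\<E>. Q \<E> \<Longrightarrow> \<D> \<subseteq> \<E> \<Longrightarrow> \<D> = \<E>"
      by auto
    have sub: "\<Union>\<D> \<subseteq> verts T - {v}"
      using \<D> Union_components[of W] vW by (auto simp: Q_def)
    have degv: "card {e \<in> edges T. v \<in> e} \<le> d"
      using deg v by blast
    show ?thesis
    proof (cases "\<D> = components W")
      case True
      then have U: "\<Union>\<D> = verts T - {v}"
        using Union_components[of W] vW by simp
      have "cut_edges T (\<Union>\<D>) \<subseteq> {e \<in> edges T. v \<in> e}"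
        using U by (auto simp: cut_edges_def edges_between_def)
      then have "card (cut_edges T (\<Union>\<D>)) \<le> d"
        using degv finE by (auto dest: card_mono[rotated])
      \<comment> \<open>All components together miss at most the centroid. The case
        \<open>t = card C\<close> has been split off, so losing one vertex still leaves at least
        \<open>t\<close>.\<close>
      moreover have "C \<subseteq> insert v (\<Union>\<D> \<inter> C)"
        using U C by auto
      then have "card C \<le> Suc (card (\<Union>\<D> \<inter> C))"
        using card_mono[of "insert v (\<Union>\<D> \<inter> C)" C] finC by (simp add: card_insert_if split: if_splits)
      then have "t \<le> card (\<Union>\<D> \<inter> C)"
        using False Suc.prems(3) by linarith
      moreover have "card (\<Union>\<D> \<inter> C) \<le> t"
        using \<D> by (simp add: Q_def)
      ultimately show ?thesis
        using sub by (intro exI[of _ "\<Union>\<D>"]) (auto simp: trans_le_add1)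
    next
      case False
      then obtain D where D: "D \<in> components W" "D \<notin> \<D>"
        using \<D> by (auto simp: Q_def)
      then have DT: "D \<subseteq> verts T - {v}"
        using component_subset[OF D(1)] vW by simp
      have disj: "\<Union>\<D> \<inter> D = {}"
      proof -
        have "E = D" if "E \<in> \<D>" "x \<in> E" "x \<in> D" for E x
          using that \<D> by (intro component_eqI[OF _ D(1) that(2,3)]) (auto simp: Q_def)
        then show ?thesis
          using D(2) by blast
      qed
      have add: "card ((\<Union>\<D> \<union> X) \<inter> C) = card (\<Union>\<D> \<inter> C) + card (X \<inter> C)" if "X \<subseteq> D" for X
        unfolding Int_Un_distrib2 using finC disj that by (intro card_Un_disjoint) auto
      \<comment> \<open>The demand that the chosen components leave open. It is met approximately
        inside \<open>D\<close>, which contains enough of \<open>C\<close> because adding all of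
        \<open>D\<close> overshoots.\<close>
      define s where "s = t - card (\<Union>\<D> \<inter> C)"
      have t: "t = card (\<Union>\<D> \<inter> C) + s"
        using \<D> by (simp add: s_def Q_def)
      have "\<not> Q (insert D \<D>)"
        using max D(2) by blast
      then have "t < card ((\<Union>\<D> \<union> D) \<inter> C)"
        using \<D> D(1) by (auto simp: Q_def Un_commute)
      then have s: "s \<le> card (D \<inter> C)"
        using add[of D] t by simp
      have "induced T D = induced W D"
        unfolding W_def using DT by (simp add: induced_induced)
      then have "connected_graph (induced T D)"
        using connected_graph_induced_component[OF sW D(1)] by simp
      then have tree: "is_tree (induced T D)"
        using is_tree_induced[OF T] DT by blast
      have "card {e \<in> edges (induced T D). x \<in> e} \<le> d" if "x \<in> D" for x
      proof -
        have "card {e \<in> edges (induced T D). x \<in> e} \<le> card {e \<in> edges T. x \<in> e}"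
          using finE by (intro card_mono) (auto simp: induced_def)
        also have "\<dots> \<le> d"
          using deg that DT by blast
        finally show ?thesis .
      qed
      then obtain A where "A \<subseteq> D" "card (cut_edges (induced T D) A) \<le> j * d"
        "card (A \<inter> (D \<inter> C)) \<le> s" "2 ^ j * s \<le> 2 ^ j * card (A \<inter> (D \<inter> C)) + card (D \<inter> C)"
        using Suc.IH[OF tree, of "D \<inter> C" s] s by (auto simp: induced_def)
      moreover from this(1) have "A \<inter> (D \<inter> C) = A \<inter> C"
        by blast
      ultimately have A: "A \<subseteq> D" "card (cut_edges (induced T D) A) \<le> j * d"
        "card (A \<inter> C) \<le> s" "2 ^ j * s \<le> 2 ^ j * card (A \<inter> C) + card (D \<inter> C)"
        by simp_all
      let ?A = "\<Union>\<D> \<union> A"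
      \<comment> \<open>Different components of \<open>T - v\<close> are joined only through
        \<open>v\<close>, so a cut edge that avoids \<open>v\<close> has both ends in
        \<open>D\<close>. Hence one more level costs at most one vertex degree.\<close>
      have "cut_edges T ?A \<subseteq> {e \<in> edges T. v \<in> e} \<union> cut_edges (induced T D) A"
      proof
        fix e assume "e \<in> cut_edges T ?A"
        then obtain a b where ab: "e = {a, b}" "{a, b} \<in> edges T" "a \<in> ?A" "b \<in> verts T" "b \<notin> ?A"
          by (elim cut_edgesE)
        show "e \<in> {e \<in> edges T. v \<in> e} \<union> cut_edges (induced T D) A"
        proof (cases "v \<in> e")
          case True
          then show ?thesis
            using ab by simp
        next
          case False
          have "a \<notin> \<Union>\<D>"
            using closed ab False \<D> unfolding Q_def by blast
          then have "a \<in> A"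
            using ab by simp
          moreover have "b \<in> D"
            using closed[OF D(1)] ab False \<open>a \<in> A\<close> A(1) by blast
          ultimately have "{a, b} \<in> cut_edges (induced T D) A"
            using ab A(1) by (intro cut_edgesI) (auto simp: induced_def)
          then show ?thesis
            using ab by simp
        qed
      qed
      then have "card (cut_edges T ?A) \<le> card ({e \<in> edges T. v \<in> e} \<union> cut_edges (induced T D) A)"
        using finE cut_edges_subset[of "induced T D" A]
        by (intro card_mono) (auto simp: induced_def intro: finite_subset)
      also have "\<dots> \<le> Suc j * d"
        using card_Un_le[of "{e \<in> edges T. v \<in> e}" "cut_edges (induced T D) A"] degv A(2) by simp
      finally have "card (cut_edges T ?A) \<le> Suc j * d" .
      moreover have "card (?A \<inter> C) = card (\<Union>\<D> \<inter> C) + card (A \<inter> C)"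
        using add A(1) by blast
      \<comment> \<open>The centroid property halves the weight, which turns the error
        \<open>card (D \<inter> C) / 2 ^ j\<close> into at most
        \<open>card C / 2 ^ Suc j\<close>.\<close>
      moreover have "2 * card (D \<inter> C) \<le> card C"
        using half D(1) by (simp add: W_def)
      ultimately show ?thesis
        using A sub DT t by (intro exI[of _ ?A]) (auto simp: algebra_simps)
    qed
  qed
qed

section \<open>Congestion and cuts\<close>

lemma finite_edge_congestions:
  assumes "simple_graph T"
  shows "finite {edge_congestion G T u v | u v. {u, v} \<in> edges T}"
proof (rule finite_subset)
  show "{edge_congestion G T u v | u v. {u, v} \<in> edges T}
    \<subseteq> (\<lambda>(u, v). edge_congestion G T u v) ` (verts T \<times> verts T)"
    using simple_graph_edge[OF assms] by fast
  show "finite ((\<lambda>(u, v). edge_congestion G T u v) ` (verts T \<times> verts T))"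
    using assms by (simp add: simple_graph_def)
qed

lemma edge_congestion_le_congestion:
  "simple_graph T \<Longrightarrow> {u, v} \<in> edges T \<Longrightarrow> edge_congestion G T u v \<le> congestion G T"
  unfolding congestion_def using finite_edge_congestions[of T G] by (intro Max_ge) auto

lemma congestion_le:
  assumes "simple_graph T" "0 \<le> b"
    and "\<And>u v. {u, v} \<in> edges T \<Longrightarrow> real (edge_congestion G T u v) \<le> b"
  shows "real (congestion G T) \<le> b"
proof -
  have "congestion G T \<in> insert 0 {edge_congestion G T u v | u v. {u, v} \<in> edges T}"
    unfolding congestion_def using finite_edge_congestions[OF assms(1), of G] by (intro Max_in) auto
  then show ?thesis
    using assms by auto
qed

text \<open>
  An edge of \<open>G\<close> that leaves \<open>A\<close> is charged to a tree edge that leaves \<open>A\<close> and separates its endpoints.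
\<close>

lemma card_cut_edges_le_congestion:
  assumes G: "simple_graph G" and T: "spanning_tree T G"
  shows "card (cut_edges G A) \<le> card (cut_edges T A) * congestion G T"
proof -
  have sT: "simple_graph T" and cT: "connected_graph T" and vT: "verts T = verts G"
    using T by (auto simp: spanning_tree_def is_tree_def)
  define X where "X u v = edges_between G (component_of (delete_edges T {{u, v}}) u)
    (component_of (delete_edges T {{u, v}}) v)" for u v
  \<comment> \<open>Charges go to tree edges, which are unordered, whereas
    \<open>edge_congestion\<close> takes ordered endpoints. The union ranges over both orientations,
    and these agree by symmetry.\<close>
  define Y where "Y f = (\<Union>{X u v | u v. f = {u, v}})" for f
  have X_commute: "X u v = X v u" for u v
    by (auto simp: X_def edges_between_def insert_commute)
  have Y: "Y {u, v} = X u v" for u v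
    unfolding Y_def using X_commute by (auto simp: doubleton_eq_iff)
  have cardY: "card (Y f) \<le> congestion G T" if "f \<in> cut_edges T A" for f
  proof -
    obtain u v where f: "f = {u, v}" "{u, v} \<in> edges T"
      using \<open>f \<in> cut_edges T A\<close> by (elim cut_edgesE)
    then show ?thesis
      using edge_congestion_le_congestion[OF sT f(2), of G] by (simp add: Y X_def edge_congestion_def Let_def)
  qed
  have finT: "finite (cut_edges T A)"
    using finite_subset[OF cut_edges_subset simple_graph_finite_edges[OF sT]] .
  have "cut_edges G A \<subseteq> (\<Union>f \<in> cut_edges T A. Y f)"
  proof
    fix e assume "e \<in> cut_edges G A"
    then obtain x y where e: "e = {x, y}" "{x, y} \<in> edges G" "x \<in> A" "y \<in> verts G" "y \<notin> A"
      by (elim cut_edgesE)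
    have xV: "x \<in> verts G"
      using simple_graph_edge[OF G e(2)] by simp
    define E where "E = edges T - cut_edges T A"
    have ET: "E \<union> cut_edges T A = edges T"
      using cut_edges_subset[of T A] by (auto simp: E_def)
    \<comment> \<open>Without the tree edges in the cut no walk of \<open>T\<close> leaves
      \<open>A\<close>; restoring them connects \<open>x\<close> to \<open>y\<close>, so one of them
      is critical.\<close>
    have "(x, y) \<notin> (adj (verts T, E))\<^sup>*"
    proof
      assume "(x, y) \<in> (adj (verts T, E))\<^sup>*"
      then obtain a b where ab: "(a, b) \<in> adj (verts T, E)" "a \<in> A" "b \<notin> A"
        using e by (meson rtrancl_exits)
      then have "{a, b} \<in> edges T" "{a, b} \<notin> cut_edges T A"
        by (auto simp: adj_def E_def)
      then show False
        using ab(2,3) cut_edgesI[of a b T A] simple_graph_edge(2)[OF sT] by blast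
    qed
    moreover have "(x, y) \<in> (adj (verts T, E \<union> cut_edges T A))\<^sup>*"
    proof -
      have "(verts T, E \<union> cut_edges T A) = T"
        by (simp add: ET)
      then show ?thesis
        using cT e(4) xV vT by (simp add: connected_graph_def)
    qed
    moreover have "\<exists>u v. f = {u, v}" if "f \<in> cut_edges T A" for f
      using that by (elim cut_edgesE) blast
    ultimately obtain u v where uv: "{u, v} \<in> cut_edges T A"
      "(x, u) \<in> (adj (verts T, edges T - {{u, v}}))\<^sup>*" "(v, y) \<in> (adj (verts T, edges T - {{u, v}}))\<^sup>*"
      using adj_rtrancl_critical_edge[OF finT, of E x y "verts T"] ET by (auto simp: E_def)
    then have "e \<in> X u v"
      using e xV vT adj_rtrancl_sym[OF uv(2)]
      by (auto simp: X_def edges_between_def component_of_def delete_edges_def)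
    then show "e \<in> (\<Union>f \<in> cut_edges T A. Y f)"
      using uv(1) Y by blast
  qed
  moreover have "finite (Y f)" for f
    by (rule finite_subset[OF _ simple_graph_finite_edges[OF G]])
      (auto simp: Y_def X_def edges_between_def)
  ultimately have "card (cut_edges G A) \<le> card (\<Union>f \<in> cut_edges T A. Y f)"
    using finT by (intro card_mono) auto
  also have "\<dots> \<le> (\<Sum>f \<in> cut_edges T A. card (Y f))"
    using finT by (rule card_UN_le)
  also have "\<dots> \<le> card (cut_edges T A) * congestion G T"
    using sum_bounded_above[of "cut_edges T A" "\<lambda>f. card (Y f)"] cardY by simp
  finally show ?thesis .
qed

section \<open>Balanced width of induced subgraphs\<close>

lemma degree_le_max_degree:
  assumes "simple_graph G" "v \<in> verts G"
  shows "card {e \<in> edges G. v \<in> e} \<le> max_degree G"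
  using assms unfolding max_degree_def simple_graph_def by (intro Max_ge) auto

text \<open>The cut of \<open>C\<close> is the trace of a cut of a spanning tree of the whole graph,
  so \<open>induced G C\<close> may well be disconnected. The second assumption makes the error
  \<open>card C / 2 ^ j\<close> small against the slack between \<open>\<beta>\<close> and
  1/2.\<close>

lemma balanced_width_induced_le:
  assumes \<beta>: "\<beta> < 1" "3 \<le> 2 ^ j * (2 * \<beta> - 1)"
    and G: "simple_graph G" and T: "spanning_tree T G" and C: "C \<subseteq> verts G"
  shows "balanced_width \<beta> (induced G C) \<le> j * max_degree G * congestion G T"
proof -
  have vT: "verts T = verts G" and eT: "edges T \<subseteq> edges G" and tT: "is_tree T"
    using T by (auto simp: spanning_tree_def)
  have finC: "finite C"
    using G C finite_subset by (auto simp: simple_graph_def)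
  define k where "k = card C"
  define m where "m = max (of_int \<lceil>real k / 2\<rceil>) (\<beta> * real k)"
  \<comment> \<open>The largest admissible size of a part. Aiming at it leaves only the other part
    to be bounded.\<close>
  define t where "t = nat \<lfloor>m\<rfloor>"
  have m: "real k / 2 \<le> of_int \<lceil>real k / 2\<rceil>" "of_int \<lceil>real k / 2\<rceil> \<le> m" "\<beta> * real k \<le> m"
    by (auto simp: m_def)
  then have "0 \<le> m"
    by linarith
  then have tm: "real t \<le> m" "m < real t + 1"
    by (auto simp: t_def)
  have "\<lceil>real k / 2\<rceil> \<le> \<lfloor>m\<rfloor>"
    using m(2) by (simp add: le_floor_iff)
  then have kt: "k \<le> 2 * t"
    using m(1) \<open>0 \<le> m\<close> unfolding t_def by linarith
  have "\<lceil>real k / 2\<rceil> \<le> int k"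
    by (simp add: ceiling_le_iff)
  moreover have "\<beta> * real k \<le> real k"
    using mult_right_mono[of \<beta> 1 "real k"] \<beta>(1) by simp
  ultimately have "m \<le> real k"
    unfolding m_def by linarith
  then have tk: "t \<le> card C"
    using tm unfolding k_def by linarith
  have deg: "card {e \<in> edges T. v \<in> e} \<le> max_degree G" if "v \<in> verts T" for v
  proof -
    have "card {e \<in> edges T. v \<in> e} \<le> card {e \<in> edges G. v \<in> e}"
      using simple_graph_finite_edges[OF G] eT by (intro card_mono) auto
    also have "\<dots> \<le> max_degree G"
      using degree_le_max_degree[OF G] that vT by simp
    finally show ?thesis .
  qed
  obtain A where A: "card (cut_edges T A) \<le> j * max_degree G" "card (A \<inter> C) \<le> t"
    "2 ^ j * t \<le> 2 ^ j * card (A \<inter> C) + card C"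
    using tree_cut_approximating_size[OF tT _ tk deg, of j] C vT by blast
  define a where "a = card (A \<inter> C)"
  have diff: "card (C - A \<inter> C) = k - a"
    unfolding k_def a_def using finC by (intro card_Diff_subset) auto
  \<comment> \<open>For \<open>k < 2 ^ j\<close> the error is below one vertex, so the target is met
    exactly and \<open>k \<le> 2 * t\<close> suffices; this is where the rounding up of
    \<open>k / 2\<close> matters. For larger \<open>k\<close> the slack in \<open>\<beta>\<close> is
    used.\<close>
  have "k - a \<le> t"
  proof (cases "k < 2 ^ j")
    case True
    then have "2 ^ j * t < 2 ^ j * (a + 1)"
      using A(3) by (simp add: a_def k_def)
    then have "t \<le> a"
      by (subst (asm) mult_less_cancel1) simp
    then show ?thesis
      using kt by linarith
  next
    case False
    \<comment> \<open>\<open>q\<close> is the error of the tree cut. The slack gives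
      \<open>2 * m \<ge> k + 3 * q\<close>; rounding \<open>m\<close> down costs less than 2, which
      is at most \<open>2 * q\<close>, and the remaining \<open>q\<close> pays for the
      error.\<close>
    define q :: real where "q = real k / 2 ^ j"
    have "1 \<le> q"
      using False by (simp add: q_def not_less numeral_power_le_of_nat_cancel_iff)
    have "real (2 ^ j * t) \<le> real (2 ^ j * a + k)"
      using A(3) unfolding a_def k_def of_nat_le_iff .
    then have "real t \<le> real a + q"
      by (simp add: q_def field_simps)
    moreover have "3 * q \<le> (2 * \<beta> - 1) * real k"
      using mult_right_mono[OF \<beta>(2), of "real k"] by (simp add: q_def field_simps)
    ultimately have "real k - real a \<le> real t"
      using m tm \<open>1 \<le> q\<close> by (simp add: algebra_simps)
    then show ?thesis
      by linarith
  qed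
  have in_set: "card (cut_edges (induced G C) (A \<inter> C)) \<in> {card (cut_edges (induced G C) S) | S.
      S \<subseteq> C \<and> real (card S) \<le> m \<and> real (card (C - S)) \<le> m}"
    using \<open>k - a \<le> t\<close> A(2) tm diff by (intro CollectI exI[of _ "A \<inter> C"]) auto
  have "finite {card (cut_edges (induced G C) S) | S.
      S \<subseteq> C \<and> real (card S) \<le> m \<and> real (card (C - S)) \<le> m}"
    by (rule finite_subset[of _ "(\<lambda>S. card (cut_edges (induced G C) S)) ` Pow C"]) (use finC in auto)
  then have "balanced_width \<beta> (induced G C) \<le> card (cut_edges (induced G C) (A \<inter> C))"
    using Min_le[OF _ in_set] by (simp add: balanced_width_def Let_def induced_def m_def k_def)
  also have "\<dots> \<le> card (cut_edges G A)"
    using simple_graph_finite_edges[OF G] cut_edges_subset[of G A] C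
    by (intro card_mono) (auto simp: cut_edges_def edges_between_def induced_def intro: finite_subset)
  also have "\<dots> \<le> card (cut_edges T A) * congestion G T"
    by (rule card_cut_edges_le_congestion[OF G T])
  also have "\<dots> \<le> j * max_degree G * congestion G T"
    using A(1) by (rule mult_right_mono) simp
  finally show ?thesis .
qed

text \<open>\<open>Min\<close> is meaningful only on a finite nonempty set. A spanning tree is
  determined by its edge set, which gives finiteness; the given tree gives nonemptiness.\<close>

lemma STC_attained:
  assumes G: "simple_graph G" and "spanning_tree T G"
  obtains T' where "spanning_tree T' G" "STC G = congestion G T'"
proof -
  have "{congestion G T | T. spanning_tree T G}
      \<subseteq> (\<lambda>E. congestion G (verts G, E)) ` Pow (edges G)"
  proof
    fix c assume "c \<in> {congestion G T | T. spanning_tree T G}"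
    then obtain T where T: "spanning_tree T G" "c = congestion G T"
      by blast
    have "T = (verts G, edges T)" "edges T \<in> Pow (edges G)"
      using T(1) by (simp_all add: spanning_tree_def prod_eq_iff)
    then show "c \<in> (\<lambda>E. congestion G (verts G, E)) ` Pow (edges G)"
      using T(2) by (metis image_eqI)
  qed
  then have "finite {congestion G T | T. spanning_tree T G}"
    using simple_graph_finite_edges[OF G] by (simp add: finite_subset)
  then have "STC G \<in> {congestion G T | T. spanning_tree T G}"
    unfolding STC_def by (rule Min_in) (use assms(2) in blast)
  then show ?thesis
    using that by blast
qed

section \<open>The recursive algorithm\<close>

text \<open>The rule \<open>split\<close> itself demands a spanning tree, so only the one-vertex
  graph needs an argument.\<close>

lemma cong_span_tree_spanning:
  assumes "cong_span_tree bcut H T" "simple_graph H"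
  shows "spanning_tree T H"
  using assms(1)
proof cases
  case single
  then obtain x where x: "verts H = {x}"
    by (auto simp: card_Suc_eq numeral_eq_Suc)
  then have "edges H = {}"
    using assms(2) by (auto simp: simple_graph_def)
  then have "\<not> is_cycle H p" for p
    by (auto simp: is_cycle_def)
  then show ?thesis
    using single x assms(2) by (auto simp: spanning_tree_def is_tree_def connected_graph_def)
qed

text \<open>An edge of \<open>H\<close> outside \<open>F\<close> has both ends in one component
  \<open>C\<close> of \<open>H - F\<close>. If it crosses the cut of \<open>uv\<close> in
  \<open>T\<close>, then \<open>uv\<close> must belong to \<open>S C\<close>, since otherwise
  \<open>S C\<close> would still join its ends. So it is already counted by the congestion of
  \<open>uv\<close> in \<open>S C\<close>, and all other crossing edges lie in
  \<open>F\<close>.\<close>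

lemma edge_congestion_join_le:
  fixes H T :: "'a graph" and b :: real
  assumes H: "simple_graph H" and T: "spanning_tree T H" and "F \<subseteq> edges H" and "F' \<subseteq> F" and "0 \<le> b"
    and trees: "\<And>C. C \<in> components (delete_edges H F) \<Longrightarrow>
      spanning_tree (S C) (induced (delete_edges H F) C)"
    and cong: "\<And>C. C \<in> components (delete_edges H F) \<Longrightarrow>
      real (congestion (induced (delete_edges H F) C) (S C)) \<le> b"
    and eT: "edges T = (\<Union>C \<in> components (delete_edges H F). edges (S C)) \<union> F'"
    and uv: "{u, v} \<in> edges T"
  shows "real (edge_congestion H T u v) \<le> real (card F) + b"
proof -
  define T' where "T' = delete_edges T {{u, v}}"
  define X where "X = edges_between H (component_of T' u) (component_of T' v)"
  let ?H = "delete_edges H F"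
  have bridge: "(u, v) \<notin> (adj T')\<^sup>*"
    unfolding T'_def using T uv by (intro tree_edge_is_bridge) (auto simp: spanning_tree_def)
  have SC: "verts (S C) = C" "connected_graph (S C)" "simple_graph (S C)" "edges (S C) \<subseteq> edges T"
    if "C \<in> components ?H" for C
    using trees[OF that] that eT by (auto simp: spanning_tree_def is_tree_def induced_def)
  have inner: "\<exists>C \<in> components ?H. {u, v} \<in> edges (S C) \<and>
      e \<in> edges_between (induced ?H C) (component_of (delete_edges (S C) {{u, v}}) u)
        (component_of (delete_edges (S C) {{u, v}}) v)"
    if "e \<in> X" "e \<notin> F" for e
  proof -
    obtain x y where e: "e = {x, y}" "{x, y} \<in> edges H" "(u, x) \<in> (adj T')\<^sup>*" "(v, y) \<in> (adj T')\<^sup>*"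
      using \<open>e \<in> X\<close> by (auto simp: X_def edges_between_def component_of_def)
    have xy: "x \<in> verts ?H" "y \<in> verts ?H" "{x, y} \<in> edges ?H"
      using simple_graph_edge[OF H e(2)] e \<open>e \<notin> F\<close> by (auto simp: delete_edges_def)
    then obtain C where C: "C \<in> components ?H" "x \<in> C"
      using Union_components[of ?H] by blast
    then have "y \<in> C"
      using component_closed_edge[OF C xy(3,2)] by simp
    note SC = SC[OF C(1)]
    have reach: "(p, q) \<in> (adj (S C))\<^sup>*" if "p \<in> C" "q \<in> C" for p q
      using SC that by (auto simp: connected_graph_def)
    have uvC: "{u, v} \<in> edges (S C)"
    proof (rule ccontr)
      assume "{u, v} \<notin> edges (S C)"
      then have "edges (S C) \<subseteq> edges T'"
        using SC by (auto simp: T'_def delete_edges_def)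
      then have "(x, y) \<in> (adj T')\<^sup>*"
        using adj_rtrancl_mono[OF reach[OF C(2) \<open>y \<in> C\<close>]] by simp
      then show False
        using bridge e(3) adj_rtrancl_sym[OF e(4)] by (meson rtrancl_trans)
    qed
    then have uC: "u \<in> C" "v \<in> C"
      using simple_graph_edge[OF SC(3)] SC(1) by auto
    let ?S = "delete_edges (S C) {{u, v}}"
    have mono: "(p, q) \<in> (adj T')\<^sup>*" if "(p, q) \<in> (adj ?S)\<^sup>*" for p q
      using that by (rule adj_rtrancl_mono) (use SC in \<open>auto simp: T'_def delete_edges_def\<close>)
    have S: "(verts (S C), insert {u, v} (edges ?S)) = S C" "(verts (S C), edges ?S) = ?S"
      using uvC by (auto simp: delete_edges_def prod_eq_iff)
    \<comment> \<open>Each vertex of \<open>C\<close> stays on the side of \<open>u\<close> or of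
      \<open>v\<close> within \<open>S C\<close>. The wrong side for \<open>x\<close> or
      \<open>y\<close> would join \<open>u\<close> to \<open>v\<close> in \<open>T'\<close>, against
      the bridge property.\<close>
    have split: "(u, p) \<in> (adj ?S)\<^sup>* \<or> (v, p) \<in> (adj ?S)\<^sup>*" if "p \<in> C" for p
      using adj_rtrancl_insert[of u p "verts (S C)" u v "edges ?S"] reach[OF uC(1) that]
      unfolding S by blast
    have "(u, x) \<in> (adj ?S)\<^sup>*"
      using split[OF C(2)] mono[of v x] bridge rtrancl_trans[OF e(3) adj_rtrancl_sym[of v x]] by blast
    moreover have "(v, y) \<in> (adj ?S)\<^sup>*"
      using split[OF \<open>y \<in> C\<close>] mono[of u y] bridge rtrancl_trans[OF _ adj_rtrancl_sym[OF e(4)]] by blast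
    ultimately have "e \<in> edges_between (induced ?H C) (component_of ?S u) (component_of ?S v)"
      using e xy C(2) \<open>y \<in> C\<close> SC(1)
      by (auto simp: edges_between_def component_of_def induced_def delete_edges_def)
    then show ?thesis
      using C(1) uvC by blast
  qed
  have finF: "finite F"
    using \<open>F \<subseteq> edges H\<close> simple_graph_finite_edges[OF H] finite_subset by blast
  have "real (card X) \<le> real (card F) + b"
  proof (cases "\<exists>C \<in> components ?H. {u, v} \<in> edges (S C)")
    case False
    then have "X \<subseteq> F"
      using inner by blast
    then show ?thesis
      using finF card_mono[of F X] \<open>0 \<le> b\<close> by linarith
  next
    case True
    then obtain C where C: "C \<in> components ?H" "{u, v} \<in> edges (S C)"
      by blast
    \<comment> \<open>The component found for an edge might depend on that edge; uniqueness puts all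
      crossing edges outside \<open>F\<close> into the single set \<open>Z\<close>.\<close>
    have unique: "D = C" if "D \<in> components ?H" "{u, v} \<in> edges (S D)" for D
    proof -
      have "u \<in> D" "u \<in> C"
        using simple_graph_edge(1)[OF SC(3)] SC(1) C that by blast+
      then show ?thesis
        using component_eqI[OF that(1) C(1)] by blast
    qed
    define Z where "Z = edges_between (induced ?H C) (component_of (delete_edges (S C) {{u, v}}) u)
        (component_of (delete_edges (S C) {{u, v}}) v)"
    have "X \<subseteq> F \<union> Z"
    proof
      fix e assume "e \<in> X"
      show "e \<in> F \<union> Z"
        using inner[OF \<open>e \<in> X\<close>] unique unfolding Z_def by auto
    qed
    moreover have "finite Z"
      by (rule finite_subset[OF _ simple_graph_finite_edges[OF H]])
        (auto simp: Z_def edges_between_def induced_def delete_edges_def)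
    ultimately have "card X \<le> card F + card Z"
      using finF by (meson card_Un_le card_mono finite_UnI le_trans)
    moreover have "card Z \<le> congestion (induced ?H C) (S C)"
      using edge_congestion_le_congestion[OF SC(3)[OF C(1)] C(2), of "induced ?H C"]
      by (simp add: Z_def edge_congestion_def Let_def)
    ultimately show ?thesis
      using cong[OF C(1)] by linarith
  qed
  then show ?thesis
    by (simp add: X_def T'_def edge_congestion_def Let_def)
qed

text \<open>Every instance of the recursion is an induced subgraph of the fixed graph
  \<open>G\<close>, so one bound \<open>B\<close> serves all cuts. Passing to a component shrinks
  the size to at most 2/3, which lowers the logarithm by at least 1 and pays for one cut.\<close>

lemma congestion_cong_span_tree_le:
  fixes B :: real
  assumes "cong_span_tree bcut H T" "H = induced G W" "W \<subseteq> verts G" "simple_graph G" "0 \<le> B"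
    and cut: "\<And>D. D \<subseteq> verts G \<Longrightarrow> 2 \<le> card D \<Longrightarrow>
      two_thirds_balanced (induced G D) (bcut (induced G D)) \<and>
      real (card (cut_edges (induced G D) (bcut (induced G D)))) \<le> B"
  shows "real (congestion H T) \<le> B * log (3 / 2) (real (card W))"
  using assms(1-3)
proof (induction arbitrary: W rule: cong_span_tree.induct)
  case (single H)
  have sH: "simple_graph H"
    using single.prems simple_graph_induced[OF assms(4)] by simp
  have W: "card W = 1"
    using single by (simp add: induced_def)
  then obtain x where "W = {x}"
    by (auto simp: card_Suc_eq numeral_eq_Suc)
  \<comment> \<open>Without edges the congestion is the inserted 0, matching the logarithm of
    1.\<close>
  then have "edges H = {}"
    using sH single.prems by (auto simp: simple_graph_def induced_def)
  then show ?case
    using W by (simp add: congestion_def)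
next
  case (split H F S T F')
  have sH: "simple_graph H"
    using split.prems simple_graph_induced[OF assms(4)] by simp
  have vH: "verts H = W"
    using split.prems by (simp add: induced_def)
  have F: "F = cut_edges H (bcut H)" and W2: "2 \<le> card W"
    using split.hyps vH by auto
  have bal: "two_thirds_balanced H (bcut H)" and cF: "real (card F) \<le> B"
    using cut[of W] split.prems F W2 by auto
  have finW: "finite W"
    using split.prems assms(4) finite_subset by (auto simp: simple_graph_def)
  let ?H = "delete_edges H F"
  define b where "b = B * (log (3 / 2) (real (card W)) - 1)"
  have ind: "induced ?H C = induced G C" and CW: "C \<subseteq> W" and Cc: "real (card C) \<le> 2 * real (card W) / 3"
    if C: "C \<in> components ?H" for C
  proof -
    show "C \<subseteq> W"
      using component_subset[OF C] vH by (simp add: delete_edges_def)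
    \<comment> \<open>After deletion of \<open>F\<close> no walk changes sides. Hence a component
      lies in one part of the balanced cut, which bounds its size, and it contains no edge of
      \<open>F\<close>, so it induces the same subgraph as in \<open>G\<close>.\<close>
    have stay: "y \<in> A" if xy: "(x, y) \<in> (adj ?H)\<^sup>*" "x \<in> A" and A: "A = bcut H \<or> A = W - bcut H" for x y A
    proof (rule ccontr)
      assume "y \<notin> A"
      then obtain a c where ac: "(a, c) \<in> adj ?H" "a \<in> A" "c \<notin> A"
        using xy by (meson rtrancl_exits)
      then have *: "{a, c} \<in> edges H" "{a, c} \<notin> F" "{c, a} \<in> edges H" "{c, a} \<notin> F"
        by (auto simp: adj_def delete_edges_def insert_commute)
      then show False
        using A ac(2,3) simple_graph_edge[OF sH *(1)] cut_edgesI[of a c H "bcut H"]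
          cut_edgesI[of c a H "bcut H"] vH F by auto
    qed
    obtain x where x: "x \<in> C"
      using component_nonempty[OF C] by blast
    then obtain A where A: "A = bcut H \<or> A = W - bcut H" "x \<in> A"
      using \<open>C \<subseteq> W\<close> by blast
    have CA: "C \<subseteq> A"
      using stay[OF _ A(2,1)] component_reachable[OF C x] by blast
    have "A \<subseteq> W" "real (card A) \<le> 2 * real (card W) / 3"
      using A bal vH by (auto simp: two_thirds_balanced_def)
    moreover have "card C \<le> card A"
      using CA finW \<open>A \<subseteq> W\<close> by (meson card_mono finite_subset)
    ultimately show "real (card C) \<le> 2 * real (card W) / 3"
      by linarith
    have "e \<notin> F" if "e \<subseteq> C" for e
      using that CA A(1) F by (auto elim!: cut_edgesE)
    then have "induced ?H C = induced H C"
      by (auto simp: induced_def delete_edges_def)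
    also have "\<dots> = induced G C"
      using split.prems(1) \<open>C \<subseteq> W\<close> by (simp add: induced_induced)
    finally show "induced ?H C = induced G C" .
  qed
  have cong: "real (congestion (induced ?H C) (S C)) \<le> b" if C: "C \<in> components ?H" for C
  proof -
    have "C \<noteq> {}" "finite C"
      using component_nonempty[OF C] CW[OF C] finW finite_subset by auto
    then have pos: "0 < real (card C)"
      by (simp add: card_gt_0_iff)
    have "real (congestion (induced ?H C) (S C)) \<le> B * log (3 / 2) (real (card C))"
      using split.IH C ind[OF C] CW[OF C] split.prems(2) by blast
    also have "\<dots> \<le> B * log (3 / 2) (real (card W) / (3 / 2))"
      using Cc[OF C] pos \<open>0 \<le> B\<close> by (intro mult_left_mono) auto
    also have "\<dots> = b"
      using W2 by (subst log_divide) (auto simp: b_def)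
    finally show ?thesis .
  qed
  have trees: "spanning_tree (S C) (induced ?H C)" if C: "C \<in> components ?H" for C
    using split.IH C ind[OF C] CW[OF C] split.prems(2) simple_graph_induced[OF assms(4), of C]
    by (intro cong_span_tree_spanning[of bcut]) auto
  have "0 \<le> b"
  proof -
    obtain x where "x \<in> W"
      using W2 by fastforce
    then obtain C where "C \<in> components ?H"
      using Union_components[of ?H] vH by (auto simp: delete_edges_def)
    then have "0 \<le> real (congestion (induced ?H C) (S C))" "real (congestion (induced ?H C) (S C)) \<le> b"
      using cong by auto
    then show ?thesis
      by linarith
  qed
  have "F \<subseteq> edges H"
    unfolding F by (rule cut_edges_subset)
  then have "real (edge_congestion H T u v) \<le> real (card F) + b" if "{u, v} \<in> edges T" for u v
    using edge_congestion_join_le[OF sH split.hyps(3) _ split.hyps(4) \<open>0 \<le> b\<close> trees cong split.hyps(5) that]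
    by blast
  then have "real (congestion H T) \<le> B + b"
    using split.hyps(3) \<open>0 \<le> B\<close> \<open>0 \<le> b\<close> cF
    by (intro congestion_le) (force simp: spanning_tree_def is_tree_def)+
  then show ?case
    by (simp add: b_def algebra_simps)
qed

section \<open>Minor-free classes and the approximation bounds\<close>

lemma has_minor_induced:
  assumes "has_minor (induced G C) M" "C \<subseteq> verts G"
  shows "has_minor G M"
proof -
  have v: "verts (induced G C) = C"
    by (simp add: induced_def)
  obtain \<phi> where \<phi>:
    "\<forall>x \<in> verts M. \<phi> x \<subseteq> C \<and> connected_graph (induced (induced G C) (\<phi> x))"
    "\<forall>x \<in> verts M. \<forall>y \<in> verts M. x \<noteq> y \<longrightarrow> \<phi> x \<inter> \<phi> y = {}"
    "\<forall>x y. {x, y} \<in> edges M \<longrightarrow> edges_between (induced G C) (\<phi> x) (\<phi> y) \<noteq> {}"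
    using assms(1) unfolding has_minor_def v by (elim exE conjE)
  have "\<phi> x \<subseteq> verts G \<and> connected_graph (induced G (\<phi> x))" if "x \<in> verts M" for x
    using \<phi>(1) that assms(2) induced_induced[of "\<phi> x" C G] by auto
  moreover have "edges_between (induced G C) X Y \<subseteq> edges_between G X Y" for X Y
    by (auto simp: edges_between_def induced_def)
  then have "\<forall>x y. {x, y} \<in> edges M \<longrightarrow> edges_between G (\<phi> x) (\<phi> y) \<noteq> {}"
    using \<phi>(3) by blast
  ultimately show ?thesis
    unfolding has_minor_def using \<phi>(2) by (intro exI[of _ \<phi>] conjI ballI) auto
qed

text \<open>The common core of both claims, for a class \<open>P\<close> that contains all induced
  subgraphs of \<open>G\<close>. All cuts of the recursion are compared with one optimal tree of
  \<open>G\<close>; the tree congestion of the subgraphs never enters.\<close>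

lemma congestion_cong_span_tree_le_STC:
  fixes a :: real
  assumes \<beta>: "\<beta> < 1" "3 \<le> 2 ^ j * (2 * \<beta> - 1)"
    and guarantee: "balanced_cut_guarantee \<beta> \<alpha> P bcut"
    and G: "simple_graph G" "connected_graph G" and T: "cong_span_tree bcut G T"
    and P: "\<And>D. D \<subseteq> verts G \<Longrightarrow> P (induced G D)"
    and a: "0 \<le> a" "\<And>k. 2 \<le> k \<Longrightarrow> k \<le> card (verts G) \<Longrightarrow> \<alpha> k \<le> a"
  shows "real (congestion G T) \<le>
    a * (real j * real (max_degree G) * real (STC G)) * log (3 / 2) (real (card (verts G)))"
proof -
  obtain T' where T': "spanning_tree T' G" "STC G = congestion G T'"
    using STC_attained[OF G(1) cong_span_tree_spanning[OF T G(1)]] .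
  have self: "G = induced G (verts G)"
    using G(1) by (auto simp: induced_def simple_graph_def prod_eq_iff)
  have "two_thirds_balanced (induced G D) (bcut (induced G D)) \<and>
      real (card (cut_edges (induced G D) (bcut (induced G D))))
        \<le> a * (real j * real (max_degree G) * real (STC G))"
    if D: "D \<subseteq> verts G" "2 \<le> card D" for D
  proof -
    have v: "verts (induced G D) = D"
      by (simp add: induced_def)
    have *: "two_thirds_balanced (induced G D) (bcut (induced G D))"
      "real (card (cut_edges (induced G D) (bcut (induced G D))))
        \<le> \<alpha> (card D) * real (balanced_width \<beta> (induced G D))"
      using guarantee[unfolded balanced_cut_guarantee_def, rule_format, of "induced G D"]
        simple_graph_induced[OF G(1) D(1)] P[OF D(1)] D(2) by (simp_all add: v)
    have "card D \<le> card (verts G)"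
      using D(1) G(1) by (auto simp: simple_graph_def intro: card_mono)
    note *(2)
    also have "\<alpha> (card D) * real (balanced_width \<beta> (induced G D))
        \<le> a * real (balanced_width \<beta> (induced G D))"
      using a(2)[OF D(2)] \<open>card D \<le> card (verts G)\<close> by (intro mult_right_mono) auto
    also have "\<dots> \<le> a * real (j * max_degree G * congestion G T')"
      using balanced_width_induced_le[OF \<beta> G(1) T'(1) D(1)] a(1)
      by (intro mult_left_mono) (simp_all only: of_nat_le_iff)
    finally show ?thesis
      using *(1) T'(2) by simp
  qed
  then show ?thesis
    using a(1) by (intro congestion_cong_span_tree_le[OF T self order_refl G(1)]) auto
qed

theorem theorem9:
  fixes M :: "'b graph" and \<beta> K :: real
  assumes "1 / 2 < \<beta>" and "\<beta> < 2 / 3" and "simple_graph M"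
  shows
    "(\<exists>c :: real. \<forall>(bcut :: 'a graph \<Rightarrow> 'a set) G T.
        balanced_cut_guarantee \<beta> (\<lambda>n. K * sqrt (ln (real n))) (\<lambda>H. True) bcut \<and>
        simple_graph G \<and> connected_graph G \<and> cong_span_tree bcut G T \<longrightarrow>
        real (congestion G T)
          \<le> c * (real (max_degree G) * ln (real (card (verts G))) powr (3 / 2)) * real (STC G))
   \<and> (\<exists>c :: real. \<forall>(bcut :: 'a graph \<Rightarrow> 'a set) G T.
        balanced_cut_guarantee \<beta> (\<lambda>n. K) (\<lambda>H. \<not> has_minor H M) bcut \<and>
        simple_graph G \<and> connected_graph G \<and> \<not> has_minor G M \<and> cong_span_tree bcut G T \<longrightarrow>
        real (congestion G T)
          \<le> c * (real (max_degree G) * ln (real (card (verts G)))) * real (STC G))"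
proof -
  have \<beta>: "\<beta> < 1" "0 < 2 * \<beta> - 1"
    using assms by auto
  \<comment> \<open>The depth depends on \<open>\<beta>\<close> alone and is absorbed into the
    constant. As \<open>\<beta>\<close> tends to 1/2 it grows without bound.\<close>
  obtain j where "3 / (2 * \<beta> - 1) < 2 ^ j"
    using real_arch_pow[of 2] by auto
  then have j: "3 \<le> 2 ^ j * (2 * \<beta> - 1)"
    using \<beta>(2) by (simp add: field_simps)
  \<comment> \<open>The absolute value keeps the factor nonnegative for every \<open>K\<close>;
    \<open>ln (3 / 2)\<close> comes from the change of base.\<close>
  define c where "c = \<bar>K\<bar> * real j / ln (3 / 2)"
  have 1: "real (congestion G T)
        \<le> c * (real (max_degree G) * ln (real (card (verts G))) powr (3 / 2)) * real (STC G)"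
    if "balanced_cut_guarantee \<beta> (\<lambda>n. K * sqrt (ln (real n))) (\<lambda>H. True) bcut"
      and G: "simple_graph G" "connected_graph G" and "cong_span_tree bcut G T"
    for bcut and G T :: "'a graph"
  proof -
    let ?n = "real (card (verts G))"
    have n: "1 \<le> ?n"
      using G by (auto simp: simple_graph_def connected_graph_def Suc_le_eq card_gt_0_iff)
    have "K * sqrt (ln (real k)) \<le> \<bar>K\<bar> * sqrt (ln ?n)" if "2 \<le> k" "k \<le> card (verts G)" for k
      using that by (intro mult_mono) auto
    then have "real (congestion G T) \<le> \<bar>K\<bar> * sqrt (ln ?n) *
        (real j * real (max_degree G) * real (STC G)) * log (3 / 2) ?n"
      using congestion_cong_span_tree_le_STC[OF \<beta>(1) j that, of "\<bar>K\<bar> * sqrt (ln ?n)"] n by simp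
    also have "\<dots> = c * (real (max_degree G) * (sqrt (ln ?n) * ln ?n)) * real (STC G)"
      by (simp add: c_def log_def)
    \<comment> \<open>The square root comes from the cut guarantee, the other factor from the
      recursion depth. For one vertex both sides are 0.\<close>
    also have "sqrt (ln ?n) * ln ?n = ln ?n powr (3 / 2)"
    proof -
      have "ln ?n powr (3 / 2) = ln ?n powr (1 / 2) * ln ?n powr 1"
        unfolding powr_add[symmetric] by simp
      then show ?thesis
        using n by (simp add: powr_half_sqrt)
    qed
    finally show ?thesis .
  qed
  have 2: "real (congestion G T)
        \<le> c * (real (max_degree G) * ln (real (card (verts G)))) * real (STC G)"
    if "balanced_cut_guarantee \<beta> (\<lambda>n. K) (\<lambda>H. \<not> has_minor H M) bcut"
      and "simple_graph G" "connected_graph G" and "\<not> has_minor G M" and "cong_span_tree bcut G T"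
    for bcut and G T :: "'a graph"
  proof -
    have "real (congestion G T) \<le> \<bar>K\<bar> *
        (real j * real (max_degree G) * real (STC G)) * log (3 / 2) (real (card (verts G)))"
      using has_minor_induced[of G _ M] that(4)
      by (intro congestion_cong_span_tree_le_STC[OF \<beta>(1) j that(1-3,5)]) auto
    also have "\<dots> = c * (real (max_degree G) * ln (real (card (verts G)))) * real (STC G)"
      by (simp add: c_def log_def)
    finally show ?thesis .
  qed
  show ?thesis
    using 1 2 by blast
qed

end
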